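(* Consider the problem of minimizing $F(x)$ over $x\in\mathcal{X}$ subject to $Lx=b$, and the algorithm LiCoSGD with parameters $\gamma,\tau>0$: given $x^0\in\mathcal{X}$, $y^0\in\mathcal{Y}$, for $k=0,1,2,\dots$ $$\begin{aligned} w^k&=x^k-\gamma g^{k+1},\\ y^{k+1}&=y^k+\tau L(w^k-\gamma L^*y^k)-\tau b,\\ x^{k+1}&=w^k-\gamma L^*y^{k+1}.\end{aligned}$$ Suppose that $(g^k)$ satisfies the Stochastic Gradient Assumption (see context) with constants $\alpha,\beta,\delta\ge0$, $\rho\in(0,1]$ and process $(\sigma_k)$, that $F$ is $\mu_F$-strongly convex for some $\mu_F>0$, and that $y^0\in\mathrm{ran}(L)$. Let $x^\star$ be the unique solution of the problem and $y^\star$ the unique element of $\mathrm{ran}(L)$ such that $\nabla F(x^\star)+L^*y^\star=0$. Suppose that $\gamma\tau\|L\|^2<1$ and $\gamma\le\frac{1}{\alpha+\kappa\delta}$, for some $\kappa>\beta/\rho$. Define, for every $k\in\mathbb{N}$, $$V^k:=\|x^k-x^\star\|^2+\big(1+\tau\gamma\,\omega(L^*L)\big)\|y^k-y^\star\|_{\gamma,\tau}^2+\kappa\gamma^2\,\mathbb{E}\sigma_k^2,$$ $$r:=\max\Big(1-\gamma\mu_F,\ 1-\rho+\frac{\beta}{\kappa},\ \frac{1}{1+\tau\gamma\,\omega(L^*L)}\Big)<1.$$ Then, for every $k\in\mathbb{N}$, $\mathbb{E}V^k\le r^kV^0$.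
   Context: $\mathcal{X},\mathcal{Y}$ are finite-dimensional real Hilbert spaces, $L:\mathcal{X}\to\mathcal{Y}$ is a nonzero linear operator with adjoint $L^*$, range $\mathrm{ran}(L)$ and operator norm $\|L\|$; $b\in\mathrm{ran}(L)$. $F:\mathcal{X}\to\mathbb{R}$ is convex and $\nu$-smooth for some $\nu>0$ (differentiable with $\nu$-Lipschitz gradient). $\omega(W)$ denotes the smallest positive eigenvalue of a positive self-adjoint linear operator $W$. $\|\cdot\|_{\gamma,\tau}$ is the norm on $\mathcal{Y}$ given by $\|y\|_{\gamma,\tau}^2=\frac{\gamma}{\tau}\|y\|^2-\gamma^2\|L^*y\|^2$. Bregman divergence: $D_F(x,x')=F(x)-F(x')-\langle\nabla F(x'),x-x'\rangle$. Stochastic Gradient Assumption: on a filtered probability space $(\Omega,\mathscr{F},(\mathscr{F}_k)_{k\in\mathbb{N}},\mathbb{P})$, with $\mathbb{E}_k$ the conditional expectation given $\mathscr{F}_k$, $(g^k)$ is an $(\mathscr{F}_k)$-adapted $\mathcal{X}$-valued process and there exist $\alpha,\beta,\delta\ge0$, $\rho\in(0,1]$ and a real $(\mathscr{F}_k)$-adapted process $(\sigma_k)_{k\in\mathbb{N}}$ such that for every $k\in\mathbb{N}$: $\mathbb{E}_k(g^{k+1})=\nabla F(x^k)$; $\mathbb{E}_k\|g^{k+1}-\nabla F(x^\star)\|^2\le2\alpha D_F(x^k,x^\star)+\beta\sigma_k^2$; $\mathbb{E}_k(\sigma_{k+1}^2)\le(1-\rho)\sigma_k^2+2\delta D_F(x^k,x^\star)$,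 where $x^k$ are the iterates of the algorithm. The initial data $x^0,y^0,\sigma_0$ are deterministic. *)

theory Defs
  imports "HOL-Probability.Probability"
begin

definition grad :: "('a::euclidean_space \<Rightarrow> real) \<Rightarrow> 'a \<Rightarrow> 'a" where
  "grad F x = (THE D. GDERIV F x :> D)"

definition smooth_fun :: "real \<Rightarrow> ('a::euclidean_space \<Rightarrow> real) \<Rightarrow> bool" where
  "smooth_fun \<nu> F \<longleftrightarrow> (\<forall>x. F differentiable (at x)) \<and> \<nu>-lipschitz_on UNIV (grad F)"

definition strongly_convex :: "real \<Rightarrow> ('a::euclidean_space \<Rightarrow> real) \<Rightarrow> bool" where
  "strongly_convex \<mu> F \<longleftrightarrow> convex_on UNIV (\<lambda>x. F x - \<mu> / 2 * (norm x)\<^sup>2)"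

definition bregman :: "('a::euclidean_space \<Rightarrow> real) \<Rightarrow> 'a \<Rightarrow> 'a \<Rightarrow> real" where
  "bregman F x x' = F x - F x' - grad F x' \<bullet> (x - x')"

text \<open>For a nonzero positive self-adjoint \<open>W\<close> the set below is finite and nonempty,
  so that \<open>Min\<close> is its least element.\<close>

definition min_pos_eigenvalue :: "('a::euclidean_space \<Rightarrow> 'a) \<Rightarrow> real" where
  "min_pos_eigenvalue W = Min {l. 0 < l \<and> (\<exists>v. v \<noteq> 0 \<and> W v = l *\<^sub>R v)}"

text \<open>The radicand is nonnegative whenever \<open>\<gamma> \<tau> \<parallel>L\<parallel>\<^sup>2 \<le> 1\<close>.\<close>

definition dual_norm ::
  "('a::euclidean_space \<Rightarrow> 'b::euclidean_space) \<Rightarrow> real \<Rightarrow> real \<Rightarrow> 'b \<Rightarrow> real" where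
  "dual_norm L \<gamma> \<tau> y = sqrt (\<gamma> / \<tau> * (norm y)\<^sup>2 - \<gamma>\<^sup>2 * (norm (adjoint L y))\<^sup>2)"

text \<open>Conditional expectation of a vector-valued random variable, taken coordinatewise because
  the library provides it for real-valued ones only. As for \<^const>\<open>real_cond_exp\<close>, the value is
  meaningful only if \<open>f\<close> is integrable.\<close>

definition vec_cond_exp ::
  "'w measure \<Rightarrow> 'w measure \<Rightarrow> ('w \<Rightarrow> 'a::euclidean_space) \<Rightarrow> 'w \<Rightarrow> 'a" where
  "vec_cond_exp M G f \<omega> = (\<Sum>i\<in>Basis. real_cond_exp M G (\<lambda>\<omega>. f \<omega> \<bullet> i) \<omega> *\<^sub>R i)"

definition adapted :: "(nat \<Rightarrow> 'w measure) \<Rightarrow> (nat \<Rightarrow> 'w \<Rightarrow> 'a::topological_space) \<Rightarrow> bool" where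
  "adapted Fil u \<longleftrightarrow> (\<forall>k. u k \<in> borel_measurable (Fil k))"

text \<open>The two second-moment conditions use the conditional expectation with values in
  \<open>[0, \<infinity>]\<close>, so that they make sense, and are not vacuous, without integrability hypotheses.
  The right-hand sides are nonnegative for convex \<open>F\<close>, so \<^const>\<open>ennreal\<close> does not truncate.\<close>

definition stochastic_gradient ::
  "'w measure \<Rightarrow> (nat \<Rightarrow> 'w measure) \<Rightarrow> ('a::euclidean_space \<Rightarrow> real) \<Rightarrow> 'a \<Rightarrow>
   (nat \<Rightarrow> 'w \<Rightarrow> 'a) \<Rightarrow> (nat \<Rightarrow> 'w \<Rightarrow> 'a) \<Rightarrow> (nat \<Rightarrow> 'w \<Rightarrow> real) \<Rightarrow>
   real \<Rightarrow> real \<Rightarrow> real \<Rightarrow> real \<Rightarrow> bool" where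
  "stochastic_gradient M Fil F xs x g \<sigma> \<alpha> \<beta> \<delta> \<rho> \<longleftrightarrow>
     prob_space M \<and> filtration (space M) Fil \<and> (\<forall>k. subalgebra M (Fil k)) \<and>
     adapted Fil g \<and> adapted Fil \<sigma> \<and>
     0 \<le> \<alpha> \<and> 0 \<le> \<beta> \<and> 0 \<le> \<delta> \<and> 0 < \<rho> \<and> \<rho> \<le> 1 \<and>
     (\<forall>k. integrable M (g (Suc k)) \<and>
          (AE \<omega> in M. vec_cond_exp M (Fil k) (g (Suc k)) \<omega> = grad F (x k \<omega>)) \<and>
          (AE \<omega> in M. nn_cond_exp M (Fil k) (\<lambda>\<omega>. ennreal ((norm (g (Suc k) \<omega> - grad F xs))\<^sup>2)) \<omega>
             \<le> ennreal (2 * \<alpha> * bregman F (x k \<omega>) xs + \<beta> * (\<sigma> k \<omega>)\<^sup>2)) \<and>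
          (AE \<omega> in M. nn_cond_exp M (Fil k) (\<lambda>\<omega>. ennreal ((\<sigma> (Suc k) \<omega>)\<^sup>2)) \<omega>
             \<le> ennreal ((1 - \<rho>) * (\<sigma> k \<omega>)\<^sup>2 + 2 * \<delta> * bregman F (x k \<omega>) xs)))"

text \<open>A single sample path of the algorithm, driven by the sequence \<open>g\<close>.\<close>

definition licosgd ::
  "('a::euclidean_space \<Rightarrow> 'b::euclidean_space) \<Rightarrow> 'b \<Rightarrow> real \<Rightarrow> real \<Rightarrow> 'a \<Rightarrow> 'b \<Rightarrow>
   (nat \<Rightarrow> 'a) \<Rightarrow> (nat \<Rightarrow> 'a) \<Rightarrow> (nat \<Rightarrow> 'b) \<Rightarrow> (nat \<Rightarrow> 'a) \<Rightarrow> bool" where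
  "licosgd L b \<gamma> \<tau> x0 y0 g x y w \<longleftrightarrow>
     x 0 = x0 \<and> y 0 = y0 \<and>
     (\<forall>k. w k = x k - \<gamma> *\<^sub>R g (Suc k) \<and>
          y (Suc k) = y k + \<tau> *\<^sub>R L (w k - \<gamma> *\<^sub>R adjoint L (y k)) - \<tau> *\<^sub>R b \<and>
          x (Suc k) = w k - \<gamma> *\<^sub>R adjoint L (y (Suc k)))"

definition lyapunov ::
  "'w measure \<Rightarrow> ('a::euclidean_space \<Rightarrow> 'b::euclidean_space) \<Rightarrow> real \<Rightarrow> real \<Rightarrow> real \<Rightarrow> 'a \<Rightarrow> 'b \<Rightarrow>
   (nat \<Rightarrow> 'w \<Rightarrow> 'a) \<Rightarrow> (nat \<Rightarrow> 'w \<Rightarrow> 'b) \<Rightarrow> (nat \<Rightarrow> 'w \<Rightarrow> real) \<Rightarrow> nat \<Rightarrow> 'w \<Rightarrow> real" where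
  "lyapunov M L \<gamma> \<tau> \<kappa> xs ys x y \<sigma> k \<omega> =
     (norm (x k \<omega> - xs))\<^sup>2
     + (1 + \<tau> * \<gamma> * min_pos_eigenvalue (adjoint L \<circ> L)) * (dual_norm L \<gamma> \<tau> (y k \<omega> - ys))\<^sup>2
     + \<kappa> * \<gamma>\<^sup>2 * (\<integral>\<omega>'. (\<sigma> k \<omega>')\<^sup>2 \<partial>M)"

definition rate ::
  "('a::euclidean_space \<Rightarrow> 'b::euclidean_space) \<Rightarrow> real \<Rightarrow> real \<Rightarrow> real \<Rightarrow> real \<Rightarrow> real \<Rightarrow> real \<Rightarrow> real" where
  "rate L \<gamma> \<tau> \<mu> \<rho> \<beta> \<kappa> =
     Max {1 - \<gamma> * \<mu>, 1 - \<rho> + \<beta> / \<kappa>, 1 / (1 + \<tau> * \<gamma> * min_pos_eigenvalue (adjoint L \<circ> L))}"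

end

theory Submission
  imports Defs
begin

text \<open>Write \<open>e = x - x\<^sup>\<star>\<close>, \<open>d = y - y\<^sup>\<star>\<close> and \<open>p = e - \<gamma> (g - \<nabla>F(x\<^sup>\<star>))\<close>. The dual update is implicit in the
  metric of the dual norm, which gives the pathwise identity
  \<open>\<parallel>e\<^sup>+\<parallel>\<^sup>2 + \<parallel>d\<^sup>+\<parallel>\<^sup>2 + \<parallel>d\<^sup>+ - d\<parallel>\<^sup>2 + \<gamma>\<^sup>2 \<parallel>L\<^sup>* d\<^sup>+\<parallel>\<^sup>2 = \<parallel>p\<parallel>\<^sup>2 + \<parallel>d\<parallel>\<^sup>2\<close> (dual norms for the terms in \<open>d\<close>
  alone). Since \<open>d\<^sup>+\<close> stays in the range of \<open>L\<close>, the last term on the left dominates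
  \<open>\<tau> \<gamma> \<omega>(L\<^sup>* L) \<parallel>d\<^sup>+\<parallel>\<^sup>2\<close>, which is the contraction in the dual variable. The mean of \<open>\<parallel>p\<parallel>\<^sup>2\<close> is estimated as for
  plain stochastic gradient descent: strong convexity produces \<open>(1 - \<gamma> \<mu>) \<parallel>e\<parallel>\<^sup>2 - 2 \<gamma> D\<close>, where \<open>D\<close> is the
  Bregman divergence, and \<open>\<gamma> (\<alpha> + \<kappa> \<delta>) \<le> 1\<close> lets the divergence terms of the second moments be absorbed.\<close>

section \<open>Gradients, convexity and Bregman divergences\<close>

lemma gderiv_grad:
  fixes F :: "'a::euclidean_space \<Rightarrow> real"
  assumes "F differentiable (at x)"
  shows "GDERIV F x :> grad F x"
proof -
  obtain F' where F': "(F has_derivative F') (at x)"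
    using assms unfolding differentiable_def by blast
  have lin: "linear F'"
    using F' has_derivative_linear by blast
  \<comment> \<open>As \<open>F'\<close> maps into the reals, its adjoint at 1 is the Riesz vector
    representing it. Since \<open>grad\<close> is a definite description, \<open>uniq\<close> below
    has to accompany \<open>ex\<close>.\<close>
  have "F' h = h \<bullet> adjoint F' 1" for h
    using adjoint_works[OF lin, of h 1] by simp
  then have "F' = (\<lambda>h. h \<bullet> adjoint F' 1)" by (rule ext)
  then have ex: "GDERIV F x :> adjoint F' 1"
    using F' by (simp add: gderiv_def)
  have uniq: "D = D'" if "GDERIV F x :> D" "GDERIV F x :> D'" for D D'
  proof -
    have "(\<lambda>h. h \<bullet> D) = (\<lambda>h. h \<bullet> D')"
      using that has_derivative_unique unfolding gderiv_def by blast
    then show ?thesis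
      by (metis vector_eq_ldot)
  qed
  show ?thesis
    unfolding grad_def by (rule theI[of _ "adjoint F' 1"]) (use ex uniq in blast)+
qed

text \<open>Restricting \<open>F\<close> to the line through \<open>x\<close> and \<open>z\<close>
  reduces this to the tangent inequality for a convex function of one real variable, with tangent at
  0 and evaluated at 1.\<close>

lemma convex_on_above_tangent_gderiv:
  fixes F :: "'a::euclidean_space \<Rightarrow> real"
  assumes "convex_on UNIV F" and "GDERIV F x :> D"
  shows "F x + (z - x) \<bullet> D \<le> F z"
proof -
  let ?f = "\<lambda>t::real. F (x + t *\<^sub>R (z - x))"
  have "convex_on UNIV ?f"
  proof (rule convex_onI)
    fix t u v :: real assume t: "0 < t" "t < 1"
    have "x + ((1 - t) *\<^sub>R u + t *\<^sub>R v) *\<^sub>R (z - x)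
        = (1 - t) *\<^sub>R (x + u *\<^sub>R (z - x)) + t *\<^sub>R (x + v *\<^sub>R (z - x))"
      by (simp add: algebra_simps)
    then show "?f ((1 - t) *\<^sub>R u + t *\<^sub>R v) \<le> (1 - t) * ?f u + t * ?f v"
      using convex_onD[OF assms(1), of t "x + u *\<^sub>R (z - x)" "x + v *\<^sub>R (z - x)"] t by simp
  qed simp
  moreover have "(?f has_real_derivative (z - x) \<bullet> D) (at 0)"
  proof -
    have "(F has_derivative (\<lambda>h. h \<bullet> D)) (at (x + 0 *\<^sub>R (z - x)))"
      using assms(2) by (simp add: gderiv_def)
    moreover have "((\<lambda>t. x + t *\<^sub>R (z - x)) has_derivative (\<lambda>t. t *\<^sub>R (z - x))) (at 0)"
      by (auto intro!: derivative_eq_intros)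
    ultimately have "(?f has_derivative (\<lambda>t. (t *\<^sub>R (z - x)) \<bullet> D)) (at 0)"
      by (rule has_derivative_compose[rotated])
    then show ?thesis
      by (simp add: has_field_derivative_def mult_commute_abs)
  qed
  ultimately have "(z - x) \<bullet> D * (1 - 0) \<le> ?f 1 - ?f 0"
    by (intro convex_on_imp_above_tangent[of UNIV]) auto
  then show ?thesis by simp
qed

text \<open>This is the tangent inequality for the convex function F - \<mu>/2 ||.||^2. The
  subtracted quadratic contributes its own Bregman divergence, \<mu>/2 ||z - x||^2.\<close>

lemma strongly_convex_bregman_ge:
  fixes F :: "'a::euclidean_space \<Rightarrow> real"
  assumes "strongly_convex \<mu> F" and "F differentiable (at x)"
  shows "\<mu> / 2 * (norm (z - x))\<^sup>2 \<le> bregman F z x"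
proof -
  have "((\<lambda>u. F u - \<mu> / 2 * (norm u)\<^sup>2) has_derivative
      (\<lambda>h. h \<bullet> (grad F x - \<mu> *\<^sub>R x))) (at x)"
    unfolding power2_norm_eq_inner
    by (rule derivative_eq_intros gderiv_grad[OF assms(2), unfolded gderiv_def] refl)+
       (simp add: inner_diff_right inner_commute fun_eq_iff)
  then have "F x - \<mu> / 2 * (norm x)\<^sup>2 + (z - x) \<bullet> (grad F x - \<mu> *\<^sub>R x)
      \<le> F z - \<mu> / 2 * (norm z)\<^sup>2"
    using assms(1) convex_on_above_tangent_gderiv unfolding strongly_convex_def gderiv_def by blast
  then show ?thesis
    by (simp add: bregman_def power2_norm_eq_inner inner_simps inner_commute algebra_simps)
qed

lemma bregman_nonneg:
  assumes "convex_on UNIV F" and "F differentiable (at x)"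
  shows "0 \<le> bregman F z x"
  using convex_on_above_tangent_gderiv[OF assms(1) gderiv_grad[OF assms(2)], of z]
  by (simp add: bregman_def inner_commute)

text \<open>The function values cancel. Once one divergence is bounded below, by convexity or strong
  convexity, the inner product controls the other.\<close>

lemma bregman_add_swap:
  "bregman F x z + bregman F z x = (x - z) \<bullet> (grad F x - grad F z)"
  by (simp add: bregman_def inner_simps inner_commute algebra_simps)

section \<open>The adjoint and the smallest positive eigenvalue\<close>

lemma norm_power2_adjoint:
  fixes L :: "'a::euclidean_space \<Rightarrow> 'b::euclidean_space"
  assumes "linear L"
  shows "(norm (adjoint L d))\<^sup>2 = d \<bullet> L (adjoint L d)"
  by (metis adjoint_works[OF assms] inner_commute power2_norm_eq_inner)

lemma norm_adjoint_le:
  fixes L :: "'a::euclidean_space \<Rightarrow> 'b::euclidean_space"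
  assumes "linear L"
  shows "norm (adjoint L d) \<le> onorm L * norm d"
proof (cases "adjoint L d = 0")
  case True
  then show ?thesis
    by (simp add: onorm_pos_le assms linear_linear)
next
  case False
  have "(norm (adjoint L d))\<^sup>2 \<le> norm d * norm (L (adjoint L d))"
    unfolding norm_power2_adjoint[OF assms] by (rule norm_cauchy_schwarz)
  also have "\<dots> \<le> norm d * (onorm L * norm (adjoint L d))"
    by (intro mult_left_mono onorm) (auto simp: assms linear_linear)
  finally show ?thesis
    using False by (simp add: power2_eq_square mult_ac)
qed

lemma norm_power2_diff_scaleR:
  fixes u v :: "'a::real_inner"
  shows "(norm (u - c *\<^sub>R v))\<^sup>2 = (norm u)\<^sup>2 - 2 * c * (u \<bullet> v) + c\<^sup>2 * (norm v)\<^sup>2"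
  unfolding power2_norm_eq_inner
  by (simp add: inner_diff_left inner_diff_right inner_commute power2_eq_square algebra_simps)

text \<open>First-order condition: the quadratic vanishes at \<open>t = 0\<close> and is
  nonnegative, so its slope there is zero.\<close>

lemma quadratic_nonneg_linear_coeff_zero:
  fixes a c :: real
  assumes "\<And>t. 0 \<le> 2 * t * a + t\<^sup>2 * c"
  shows "a = 0"
proof -
  \<comment> \<open>This \<open>s\<close> is positive and large enough that at
    \<open>t = - a / s\<close> the linear term wins: the value is negative unless
    \<open>a = 0\<close>.\<close>
  define s where "s = \<bar>c\<bar> + 1"
  have s: "s > 0" "c < 2 * s" by (auto simp: s_def)
  have "0 \<le> s\<^sup>2 * (2 * (- a / s) * a + (- a / s)\<^sup>2 * c)"
    using assms[of "- a / s"] by simp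
  also have "\<dots> = a\<^sup>2 * (c - 2 * s)"
    using s by (simp add: field_simps power2_eq_square)
  finally show ?thesis
    using s by (simp add: zero_le_mult_iff)
qed

text \<open>The minimum of \<open>\<parallel>L\<^sup>*v\<parallel>\<^sup>2\<close> over the unit sphere of the range of \<open>L\<close> is an eigenvalue of
  \<open>L L\<^sup>*\<close>, hence of \<open>L\<^sup>* L\<close>, and it is a lower bound for all positive eigenvalues of the latter.
  This variational argument replaces the spectral theorem.\<close>

lemma min_pos_eigenvalue_adjoint_comp:
  fixes L :: "'a::euclidean_space \<Rightarrow> 'b::euclidean_space"
  assumes lin: "linear L" and nz: "L \<noteq> (\<lambda>_. 0)"
  shows "0 < min_pos_eigenvalue (adjoint L \<circ> L)"
    and "d \<in> range L \<Longrightarrow> min_pos_eigenvalue (adjoint L \<circ> L) * (norm d)\<^sup>2 \<le> (norm (adjoint L d))\<^sup>2"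
proof -
  define A where "A = adjoint L"
  have linA: "linear A" unfolding A_def by (rule adjoint_linear[OF lin])
  have AL: "A u \<bullet> z = u \<bullet> L z" for u z
    using adjoint_works[OF lin, of z u] by (simp add: A_def inner_commute)
  have nA: "(norm (A d))\<^sup>2 = d \<bullet> L (A d)" for d
    using norm_power2_adjoint[OF lin] by (simp add: A_def)
  have sub: "subspace (range L)" using lin by (simp add: linear_subspace_image)
  define S where "S = sphere 0 1 \<inter> range L"
  obtain u where "L u \<noteq> 0" using nz by blast
  then have "L u /\<^sub>R norm (L u) \<in> S"
    unfolding S_def using sub by (auto intro: subspace_scale)
  moreover have "compact S"
    unfolding S_def by (intro compact_Int_closed compact_sphere closed_subspace sub)
  moreover have "continuous_on S (\<lambda>d. (norm (A d))\<^sup>2)"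
    by (intro continuous_intros linear_continuous_on_compose[OF continuous_on_id linA])
  ultimately obtain v where v: "v \<in> S" and min: "\<And>d. d \<in> S \<Longrightarrow> (norm (A v))\<^sup>2 \<le> (norm (A d))\<^sup>2"
    using continuous_attains_inf[of S "\<lambda>d. (norm (A d))\<^sup>2"] by blast
  define l where "l = (norm (A v))\<^sup>2"
  have nv: "norm v = 1" and vr: "v \<in> range L" using v by (auto simp: S_def)
  \<comment> \<open>Homogeneity extends the minimality of \<open>v\<close> from the unit sphere to
    the whole range.\<close>
  have bound: "l * (norm d)\<^sup>2 \<le> (norm (A d))\<^sup>2" if "d \<in> range L" for d
  proof (cases "d = 0")
    case False
    then have "d /\<^sub>R norm d \<in> S"
      unfolding S_def using sub that by (auto intro: subspace_scale)
    from min[OF this] have "l \<le> (norm (A d) / norm d)\<^sup>2"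
      using linA by (simp add: l_def linear_scale divide_inverse mult.commute)
    then show ?thesis using False by (simp add: power_divide field_simps)
  qed (simp add: linA linear_0)
  have Avz: "A v \<noteq> 0"
  proof
    assume "A v = 0"
    obtain z where "v = L z" using vr by blast
    then have "v \<bullet> v = A v \<bullet> z" by (simp add: AL)
    then show False using \<open>A v = 0\<close> nv by (simp add: norm_eq_1)
  qed
  then have lpos: "0 < l" by (simp add: l_def)
  \<comment> \<open>The residual of the eigenvalue equation, which is also half the gradient at
    \<open>v\<close> of ||A d||^2 - l ||d||^2. It lies in the range, so \<open>v\<close> may be
    perturbed along it.\<close>
  define h where "h = L (A v) - l *\<^sub>R v"
  have hr: "h \<in> range L"
    unfolding h_def using sub vr by (intro subspace_diff subspace_scale) auto
  have "h \<bullet> h = L (A v) \<bullet> h - l * (v \<bullet> h)"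
    by (subst (1) h_def) (simp add: inner_diff_left)
  then have hh: "h \<bullet> h = A v \<bullet> A h - l * (v \<bullet> h)"
    using AL[of h "A v"] by (simp add: inner_commute)
  \<comment> \<open>This is \<open>bound\<close> at \<open>v + t *\<^sub>R h\<close>; the terms of
    order zero cancel because \<open>v\<close> has norm 1 and attains the minimum
    \<open>l\<close>.\<close>
  have "0 \<le> 2 * t * (h \<bullet> h) + t\<^sup>2 * ((norm (A h))\<^sup>2 - l * (norm h)\<^sup>2)" for t
  proof -
    have "v + t *\<^sub>R h \<in> range L"
      using sub vr hr by (intro subspace_add subspace_scale)
    from bound[OF this]
    have "l * (norm (v + t *\<^sub>R h))\<^sup>2 \<le> (norm (A v + t *\<^sub>R A h))\<^sup>2"
      using linA by (simp add: linear_add linear_scale)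
    then have "l * ((norm v)\<^sup>2 + 2 * t * (v \<bullet> h) + t\<^sup>2 * (norm h)\<^sup>2)
        \<le> (norm (A v))\<^sup>2 + 2 * t * (A v \<bullet> A h) + t\<^sup>2 * (norm (A h))\<^sup>2"
      using norm_power2_diff_scaleR[of v "- t" h] norm_power2_diff_scaleR[of "A v" "- t" "A h"] by simp
    then have "0 \<le> 2 * t * (A v \<bullet> A h - l * (v \<bullet> h)) + t\<^sup>2 * ((norm (A h))\<^sup>2 - l * (norm h)\<^sup>2)"
      unfolding nv l_def[symmetric] by (simp add: algebra_simps)
    then show ?thesis unfolding hh .
  qed
  then have "h \<bullet> h = 0" by (rule quadratic_nonneg_linear_coeff_zero)
  then have LAv: "L (A v) = l *\<^sub>R v" by (simp add: h_def)
  let ?E = "{l. 0 < l \<and> (\<exists>v. v \<noteq> 0 \<and> (A \<circ> L) v = l *\<^sub>R v)}"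
  \<comment> \<open>Applying \<open>A\<close> to \<open>LAv\<close> turns the eigenvector
    \<open>v\<close> of L L* into the nonzero eigenvector \<open>A v\<close> of L* L.\<close>
  have lE: "l \<in> ?E"
    using lpos Avz LAv linA by (auto simp: linear_scale intro!: exI[of _ "A v"])
  \<comment> \<open>\<open>L\<close> sends an eigenvector for \<open>m\<close> to a nonzero vector
    of the range at which ||A d||^2 / ||d||^2 equals \<open>m\<close>.\<close>
  have low: "l \<le> m" if mE: "m \<in> ?E" for m
  proof -
    obtain z where z: "z \<noteq> 0" "A (L z) = m *\<^sub>R z" "0 < m" using mE by auto
    have "L z \<noteq> 0" using z linA by (auto simp: linear_0)
    moreover have "(norm (A (L z)))\<^sup>2 = m * (norm (L z))\<^sup>2"
      by (subst nA) (simp add: z(2) linear_scale[OF lin] power2_norm_eq_inner)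
    ultimately show ?thesis using bound[of "L z"] by simp
  qed
  \<comment> \<open>\<open>Min\<close> is meaningful only on a finite set. Choosing one eigenvector
    per eigenvalue gives an orthogonal, hence independent, hence finite family, and the choice is
    injective.\<close>
  have "finite ?E"
  proof -
    have "\<forall>m\<in>?E. \<exists>v. v \<noteq> 0 \<and> A (L v) = m *\<^sub>R v" by simp
    from bchoice[OF this] obtain e where "\<forall>m\<in>?E. e m \<noteq> 0 \<and> A (L (e m)) = m *\<^sub>R e m" ..
    then have e: "e m \<noteq> 0 \<and> A (L (e m)) = m *\<^sub>R e m" if "m \<in> ?E" for m
      using that by (rule bspec)
    have orth: "e m \<bullet> e n = 0" if "m \<in> ?E" "n \<in> ?E" "m \<noteq> n" for m n
    proof -
      have "m * (e m \<bullet> e n) = n * (e m \<bullet> e n)"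
        using e[OF that(1)] e[OF that(2)]
        by (metis AL inner_commute inner_scaleR_left)
      then show ?thesis using that(3) by simp
    qed
    have inj: "inj_on e ?E"
    proof (rule inj_onI, rule ccontr)
      fix m n assume mn: "m \<in> ?E" "n \<in> ?E" "e m = e n" "m \<noteq> n"
      have "e m \<bullet> e n = 0" by (rule orth[OF mn(1,2,4)])
      then show False using mn(3) e[OF mn(1)] by simp
    qed
    have "independent (e ` ?E)"
    proof (rule pairwise_orthogonal_independent)
      show "pairwise orthogonal (e ` ?E)"
        unfolding pairwise_def orthogonal_def using orth by blast
      show "0 \<notin> e ` ?E" using e by fastforce
    qed
    then show ?thesis
      using inj finite_imageD independent_imp_finite by blast
  qed
  then have "Min ?E = l" using lE low by (intro Min_eqI) auto
  then have eq: "min_pos_eigenvalue (adjoint L \<circ> L) = l"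
    by (simp add: min_pos_eigenvalue_def A_def)
  show "0 < min_pos_eigenvalue (adjoint L \<circ> L)" using eq lpos by simp
  show "min_pos_eigenvalue (adjoint L \<circ> L) * (norm d)\<^sup>2 \<le> (norm (adjoint L d))\<^sup>2"
    if "d \<in> range L"
    using bound[OF that] eq by (simp add: A_def)
qed

section \<open>The dual norm and the deterministic step\<close>

lemma dual_norm_power2:
  fixes L :: "'a::euclidean_space \<Rightarrow> 'b::euclidean_space"
  assumes "linear L" and "0 < \<gamma>" and "0 < \<tau>" and "\<gamma> * \<tau> * (onorm L)\<^sup>2 \<le> 1"
  shows "(dual_norm L \<gamma> \<tau> d)\<^sup>2 = \<gamma> / \<tau> * (norm d)\<^sup>2 - \<gamma>\<^sup>2 * (norm (adjoint L d))\<^sup>2"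
proof -
  \<comment> \<open>The step-size condition makes the radicand nonnegative, so that squaring undoes
    the \<open>sqrt\<close>.\<close>
  have "\<gamma>\<^sup>2 * (norm (adjoint L d))\<^sup>2 \<le> \<gamma>\<^sup>2 * (onorm L * norm d)\<^sup>2"
    by (intro mult_left_mono power_mono norm_adjoint_le assms) auto
  also have "\<dots> = \<gamma> / \<tau> * (norm d)\<^sup>2 * (\<gamma> * \<tau> * (onorm L)\<^sup>2)"
    using assms(3) by (simp add: power2_eq_square field_simps)
  also have "\<dots> \<le> \<gamma> / \<tau> * (norm d)\<^sup>2"
    using assms by (intro mult_left_le) auto
  finally show ?thesis
    unfolding dual_norm_def by simp
qed

text \<open>With \<open>p = w - w\<^sup>\<star>\<close>, \<open>d = y - y\<^sup>\<star>\<close>, \<open>d' = y\<^sup>+ - y\<^sup>\<star>\<close>, the dual update reads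
  \<open>(d' - d) / \<tau> - \<gamma> L L\<^sup>* (d' - d) = L (p - \<gamma> L\<^sup>* d')\<close>: the dual step is implicit in the metric of
  \<^const>\<open>dual_norm\<close>.\<close>

lemma licosgd_step_le:
  fixes L :: "'a::euclidean_space \<Rightarrow> 'b::euclidean_space" and p :: 'a and d d' :: 'b
  assumes L: "linear L" "L \<noteq> (\<lambda>_. 0)" and \<gamma>: "0 < \<gamma>" and \<tau>: "0 < \<tau>" and step: "\<gamma> * \<tau> * (onorm L)\<^sup>2 \<le> 1"
    and d': "d' = d + \<tau> *\<^sub>R L (p - \<gamma> *\<^sub>R adjoint L d)" and ran: "d \<in> range L"
  shows "(norm (p - \<gamma> *\<^sub>R adjoint L d'))\<^sup>2
      + (1 + \<tau> * \<gamma> * min_pos_eigenvalue (adjoint L \<circ> L)) * (dual_norm L \<gamma> \<tau> d')\<^sup>2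
    \<le> (norm p)\<^sup>2 + (dual_norm L \<gamma> \<tau> d)\<^sup>2"
proof -
  define A where "A = adjoint L"
  define \<omega> where "\<omega> = min_pos_eigenvalue (adjoint L \<circ> L)"
  define N where "N = (\<lambda>y. \<gamma> / \<tau> * (norm y)\<^sup>2 - \<gamma>\<^sup>2 * (norm (A y))\<^sup>2)"
  have linA: "linear A" unfolding A_def by (rule adjoint_linear[OF L(1)])
  have N: "(dual_norm L \<gamma> \<tau> y)\<^sup>2 = N y" for y
    unfolding N_def A_def by (rule dual_norm_power2[OF L(1) \<gamma> \<tau> step])
  define u where "u = d' - d"
  have d: "d = d' - u" by (simp add: u_def)
  have u: "u = \<tau> *\<^sub>R L (p - \<gamma> *\<^sub>R A d)" by (simp add: u_def d' A_def)
  have "u \<bullet> d' = \<tau> * ((p - \<gamma> *\<^sub>R A d) \<bullet> A d')"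
    unfolding u A_def by (simp add: adjoint_works[OF L(1)])
  also have "\<dots> = \<tau> * (p \<bullet> A d' - \<gamma> * (A d' \<bullet> A d') + \<gamma> * (A u \<bullet> A d'))"
    unfolding d using linA by (simp add: linear_diff inner_simps algebra_simps)
  finally have "\<gamma> / \<tau> * (u \<bullet> d')
      = \<gamma> * (p \<bullet> A d' - \<gamma> * (A d' \<bullet> A d') + \<gamma> * (A u \<bullet> A d'))"
    using \<tau> by simp
  \<comment> \<open>Moving the \<open>A u\<close> term to the left gives the bilinear form of
    \<open>N\<close> at \<open>(u, d')\<close>, which therefore depends only on \<open>p\<close> and
    \<open>A d'\<close>.\<close>
  then have ud': "\<gamma> / \<tau> * (u \<bullet> d')
      = \<gamma> * (p \<bullet> A d') - \<gamma>\<^sup>2 * (A d' \<bullet> A d') + \<gamma>\<^sup>2 * (A u \<bullet> A d')"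
    by (simp add: power2_eq_square algebra_simps)
  \<comment> \<open>Polarization of the quadratic form \<open>N\<close> at \<open>d' - u\<close>,
    that is, expansion around the new point.\<close>
  have "N d = N d' + N u - 2 * (\<gamma> / \<tau> * (u \<bullet> d') - \<gamma>\<^sup>2 * (A u \<bullet> A d'))"
    unfolding d N_def power2_norm_eq_inner using linA
    by (simp add: linear_diff inner_simps inner_commute algebra_simps)
  then have "N d = N d' + N u - 2 * \<gamma> * (p \<bullet> A d') + 2 * \<gamma>\<^sup>2 * (norm (A d'))\<^sup>2"
    unfolding ud' power2_norm_eq_inner by simp
  \<comment> \<open>The inner products of \<open>p\<close> with \<open>A d'\<close> cancel between
    the two expansions, which leaves one surplus \<gamma>^2 ||A d'||^2.\<close>
  moreover note norm_power2_diff_scaleR[of p \<gamma> "A d'"]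
  ultimately have "(norm (p - \<gamma> *\<^sub>R A d'))\<^sup>2 + N d' + N u + \<gamma>\<^sup>2 * (norm (A d'))\<^sup>2 = (norm p)\<^sup>2 + N d"
    by simp
  moreover have "0 \<le> N u" using N[of u] by (metis zero_le_power2)
  \<comment> \<open>The surplus pays for the contraction: the negative part of \<open>N d'\<close>
    is dropped, and the eigenvalue bound applies because \<open>d'\<close> is again in the
    range.\<close>
  moreover have "\<tau> * \<gamma> * \<omega> * N d' \<le> \<gamma>\<^sup>2 * (norm (A d'))\<^sup>2"
  proof -
    have sub: "subspace (range L)" using L(1) by (simp add: linear_subspace_image)
    have "d' \<in> range L"
      unfolding d' using ran by (intro subspace_add[OF sub] subspace_scale[OF sub]) auto
    then have ev: "\<omega> * (norm d')\<^sup>2 \<le> (norm (A d'))\<^sup>2"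
      unfolding \<omega>_def A_def by (rule min_pos_eigenvalue_adjoint_comp(2)[OF L])
    have "0 < \<omega>" unfolding \<omega>_def by (rule min_pos_eigenvalue_adjoint_comp(1)[OF L])
    then have "\<tau> * \<gamma> * \<omega> * N d' \<le> \<tau> * \<gamma> * \<omega> * (\<gamma> / \<tau> * (norm d')\<^sup>2)"
      using \<gamma> \<tau> by (intro mult_left_mono) (auto simp: N_def)
    also have "\<dots> = \<gamma>\<^sup>2 * (\<omega> * (norm d')\<^sup>2)"
      using \<tau> by (simp add: power2_eq_square)
    also have "\<dots> \<le> \<gamma>\<^sup>2 * (norm (A d'))\<^sup>2"
      using ev by (intro mult_left_mono) auto
    finally show ?thesis .
  qed
  ultimately have "(norm (p - \<gamma> *\<^sub>R A d'))\<^sup>2 + (1 + \<tau> * \<gamma> * \<omega>) * N d' \<le> (norm p)\<^sup>2 + N d"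
    by (simp add: algebra_simps)
  then show ?thesis
    unfolding N \<omega>_def A_def .
qed

section \<open>Square integrability and conditional expectation\<close>

lemma integrable_inner_square_integrable:
  fixes f h :: "'w \<Rightarrow> 'a::euclidean_space"
  assumes [measurable]: "f \<in> borel_measurable M" "h \<in> borel_measurable M"
    and "integrable M (\<lambda>\<omega>. (norm (f \<omega>))\<^sup>2)" and "integrable M (\<lambda>\<omega>. (norm (h \<omega>))\<^sup>2)"
  shows "integrable M (\<lambda>\<omega>. f \<omega> \<bullet> h \<omega>)"
proof (rule Bochner_Integration.integrable_bound)
  show "integrable M (\<lambda>\<omega>. (norm (f \<omega>))\<^sup>2 + (norm (h \<omega>))\<^sup>2)"
    using assms(3,4) by (rule Bochner_Integration.integrable_add)
  have "\<bar>u \<bullet> v\<bar> \<le> (norm u)\<^sup>2 + (norm v)\<^sup>2" for u v :: 'a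
  proof -
    have "\<bar>u \<bullet> v\<bar> \<le> norm u * norm v" by (rule Cauchy_Schwarz_ineq2)
    also have "\<dots> \<le> (norm u)\<^sup>2 + (norm v)\<^sup>2"
      using sum_squares_bound[of "norm u" "norm v"] zero_le_power2[of "norm u - norm v"]
        mult_nonneg_nonneg[OF norm_ge_zero norm_ge_zero, of u v] by linarith
    finally show ?thesis .
  qed
  then show "AE \<omega> in M. norm (f \<omega> \<bullet> h \<omega>) \<le> norm ((norm (f \<omega>))\<^sup>2 + (norm (h \<omega>))\<^sup>2)"
    by simp
qed measurable

lemma integrable_norm_power2_add:
  fixes f h :: "'w \<Rightarrow> 'a::euclidean_space"
  assumes "f \<in> borel_measurable M" "h \<in> borel_measurable M"
    and "integrable M (\<lambda>\<omega>. (norm (f \<omega>))\<^sup>2)" and "integrable M (\<lambda>\<omega>. (norm (h \<omega>))\<^sup>2)"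
  shows "integrable M (\<lambda>\<omega>. (norm (f \<omega> + h \<omega>))\<^sup>2)"
proof -
  have "(norm (f \<omega> + h \<omega>))\<^sup>2 = (norm (f \<omega>))\<^sup>2 + 2 * (f \<omega> \<bullet> h \<omega>) + (norm (h \<omega>))\<^sup>2" for \<omega>
    by (simp add: power2_norm_eq_inner inner_simps inner_commute)
  then show ?thesis
    using integrable_inner_square_integrable[OF assms] assms(3,4) by simp
qed

lemma borel_measurable_linear:
  fixes T :: "'a::euclidean_space \<Rightarrow> 'b::euclidean_space"
  assumes "linear T" and [measurable]: "f \<in> borel_measurable M"
  shows "(\<lambda>\<omega>. T (f \<omega>)) \<in> borel_measurable M"
  using assms(1) by (intro borel_measurable_continuous_on[OF _ assms(2)]
    linear_continuous_on linear_linear[THEN iffD2])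

lemma integrable_norm_power2_linear:
  fixes f :: "'w \<Rightarrow> 'a::euclidean_space" and T :: "'a \<Rightarrow> 'b::euclidean_space"
  assumes T: "linear T" and f [measurable]: "f \<in> borel_measurable M"
    and int: "integrable M (\<lambda>\<omega>. (norm (f \<omega>))\<^sup>2)"
  shows "integrable M (\<lambda>\<omega>. (norm (T (f \<omega>)))\<^sup>2)"
proof (rule Bochner_Integration.integrable_bound)
  show "integrable M (\<lambda>\<omega>. (onorm T)\<^sup>2 * (norm (f \<omega>))\<^sup>2)"
    using int by simp
  show "(\<lambda>\<omega>. (norm (T (f \<omega>)))\<^sup>2) \<in> borel_measurable M"
    using borel_measurable_linear[OF T f] by measurable
  have "(norm (T u))\<^sup>2 \<le> (onorm T)\<^sup>2 * (norm u)\<^sup>2" for u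
    unfolding power_mult_distrib[symmetric]
    by (intro power_mono onorm) (auto simp: T linear_linear)
  then show "AE \<omega> in M. norm ((norm (T (f \<omega>)))\<^sup>2) \<le> norm ((onorm T)\<^sup>2 * (norm (f \<omega>))\<^sup>2)"
    by simp
qed

text \<open>The tower property with the \<open>F\<close>-measurable factor pulled out, applied to
  each coordinate. Square integrability makes every coordinate product integrable, as
  \<open>real_cond_exp_intg\<close> demands.\<close>

lemma (in sigma_finite_subalgebra) integral_inner_vec_cond_exp:
  fixes f g h :: "'a \<Rightarrow> 'b::euclidean_space"
  assumes f [measurable]: "f \<in> borel_measurable F" and g [measurable]: "g \<in> borel_measurable M"
    and h [measurable]: "h \<in> borel_measurable M"
    and int: "integrable M (\<lambda>\<omega>. (norm (f \<omega>))\<^sup>2)" "integrable M (\<lambda>\<omega>. (norm (g \<omega>))\<^sup>2)"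
    and ce: "AE \<omega> in M. vec_cond_exp M F g \<omega> = h \<omega>"
  shows "(\<integral>\<omega>. f \<omega> \<bullet> g \<omega> \<partial>M) = (\<integral>\<omega>. f \<omega> \<bullet> h \<omega> \<partial>M)"
proof -
  have fM [measurable]: "f \<in> borel_measurable M"
    by (rule measurable_from_subalg[OF subalg f])
  have coord: "integrable M (\<lambda>\<omega>. (u \<omega> \<bullet> i)\<^sup>2)"
    if "u \<in> borel_measurable M" "integrable M (\<lambda>\<omega>. (norm (u \<omega>))\<^sup>2)" for u :: "'a \<Rightarrow> 'b" and i
    using integrable_norm_power2_linear[OF bounded_linear.linear[OF bounded_linear_inner_left] that]
    by simp
  have fg: "integrable M (\<lambda>\<omega>. (f \<omega> \<bullet> i) * (g \<omega> \<bullet> i))" for i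
    using integrable_inner_square_integrable[of "\<lambda>\<omega>. f \<omega> \<bullet> i" M "\<lambda>\<omega>. g \<omega> \<bullet> i"]
      coord[OF fM int(1), of i] coord[OF g int(2), of i] by simp
  have mf: "(\<lambda>\<omega>. f \<omega> \<bullet> i) \<in> borel_measurable F" for i by measurable
  have mg: "(\<lambda>\<omega>. g \<omega> \<bullet> i) \<in> borel_measurable M" for i by measurable
  note ce_intg = real_cond_exp_intg[OF fg mf mg]
  have "(\<integral>\<omega>. f \<omega> \<bullet> g \<omega> \<partial>M) = (\<Sum>i\<in>Basis. \<integral>\<omega>. (f \<omega> \<bullet> i) * (g \<omega> \<bullet> i) \<partial>M)"
    by (subst euclidean_inner, rule Bochner_Integration.integral_sum) (rule fg)
  also have "\<dots> = (\<integral>\<omega>. (\<Sum>i\<in>Basis. (f \<omega> \<bullet> i) * real_cond_exp M F (\<lambda>\<omega>. g \<omega> \<bullet> i) \<omega>) \<partial>M)"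
    using ce_intg by simp
  also have "\<dots> = (\<integral>\<omega>. f \<omega> \<bullet> h \<omega> \<partial>M)"
  proof (rule integral_cong_AE)
    show "AE \<omega> in M. (\<Sum>i\<in>Basis. (f \<omega> \<bullet> i) * real_cond_exp M F (\<lambda>\<omega>. g \<omega> \<bullet> i) \<omega>) = f \<omega> \<bullet> h \<omega>"
      using ce
    proof eventually_elim
      case (elim \<omega>)
      then have "f \<omega> \<bullet> h \<omega> = f \<omega> \<bullet> vec_cond_exp M F g \<omega>" by simp
      then show ?case
        by (simp add: vec_cond_exp_def inner_sum_right mult.commute)
    qed
  qed measurable
  finally show ?thesis .
qed

text \<open>The nonnegative conditional expectation preserves the total integral even before
  integrability is known. A finite bound thus yields integrability too, which is how second moments
  propagate along the iteration.\<close>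

lemma (in sigma_finite_subalgebra) integral_le_of_nn_cond_exp_le:
  assumes [measurable]: "Z \<in> borel_measurable M" and B: "integrable M B"
    and nn: "\<And>\<omega>. 0 \<le> Z \<omega>" "\<And>\<omega>. 0 \<le> B \<omega>"
    and ce: "AE \<omega> in M. nn_cond_exp M F (\<lambda>\<omega>. ennreal (Z \<omega>)) \<omega> \<le> ennreal (B \<omega>)"
  shows "integrable M Z" and "(\<integral>\<omega>. Z \<omega> \<partial>M) \<le> (\<integral>\<omega>. B \<omega> \<partial>M)"
proof -
  have "(\<integral>\<^sup>+\<omega>. ennreal (Z \<omega>) \<partial>M) = (\<integral>\<^sup>+\<omega>. nn_cond_exp M F (\<lambda>\<omega>. ennreal (Z \<omega>)) \<omega> \<partial>M)"
    using nn_cond_exp_intg[of "\<lambda>_. 1" "\<lambda>\<omega>. ennreal (Z \<omega>)"] by simp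
  also have "\<dots> \<le> (\<integral>\<^sup>+\<omega>. ennreal (B \<omega>) \<partial>M)"
    by (rule nn_integral_mono_AE[OF ce])
  also have "\<dots> = ennreal (\<integral>\<omega>. B \<omega> \<partial>M)"
    using B nn by (intro nn_integral_eq_integral) auto
  finally have le: "(\<integral>\<^sup>+\<omega>. ennreal (Z \<omega>) \<partial>M) \<le> ennreal (\<integral>\<omega>. B \<omega> \<partial>M)" .
  show int: "integrable M Z"
    using le_less_trans[OF le ennreal_less_top] nn by (intro integrableI_nonneg) auto
  have "ennreal (\<integral>\<omega>. Z \<omega> \<partial>M) \<le> ennreal (\<integral>\<omega>. B \<omega> \<partial>M)"
    using le nn int by (subst nn_integral_eq_integral[symmetric]) auto
  then show "(\<integral>\<omega>. Z \<omega> \<partial>M) \<le> (\<integral>\<omega>. B \<omega> \<partial>M)"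
    using nn by (simp add: ennreal_le_iff integral_nonneg_AE)
qed

section \<open>One stochastic gradient step in mean\<close>

lemma continuous_on_grad_smooth:
  "smooth_fun \<nu> F \<Longrightarrow> continuous_on UNIV (grad F)"
  unfolding smooth_fun_def by (blast intro: lipschitz_on_continuous_on)

lemma continuous_on_bregman_smooth:
  assumes "smooth_fun \<nu> F"
  shows "continuous_on UNIV (\<lambda>x. bregman F x z)"
proof -
  have "continuous_on UNIV F"
    using assms unfolding smooth_fun_def
    by (simp add: continuous_at_imp_continuous_on differentiable_imp_continuous_within)
  then show ?thesis
    unfolding bregman_def by (intro continuous_intros)
qed

text \<open>Adding the nonnegative swapped divergence leaves an inner product that Cauchy-Schwarz
  and the Lipschitz bound control. The constant is not sharp; the bound serves for integrability of
  the divergence.\<close>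

lemma smooth_convex_bregman_le:
  assumes "convex_on UNIV F" and "smooth_fun \<nu> F"
  shows "bregman F x z \<le> \<nu> * (norm (x - z))\<^sup>2"
proof -
  have "bregman F x z \<le> (x - z) \<bullet> (grad F x - grad F z)"
    using bregman_add_swap[of F x z] bregman_nonneg[OF assms(1), of x z] assms(2)
    by (simp add: smooth_fun_def)
  also have "\<dots> \<le> norm (x - z) * norm (grad F x - grad F z)"
    by (rule norm_cauchy_schwarz)
  also have "\<dots> \<le> norm (x - z) * (\<nu> * norm (x - z))"
    using assms(2) unfolding smooth_fun_def lipschitz_on_def dist_norm
    by (intro mult_left_mono) auto
  finally show ?thesis by (simp add: power2_eq_square mult_ac)
qed

text \<open>The cross term of the expanded square yields a divergence that pays for those in both
  second-moment bounds. The weight \<kappa>\<gamma>^2 turns the noise coefficient \<gamma>^2 \<beta>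
  into the summand \<beta>/\<kappa> of the factor of \<sigma>^2.\<close>

lemma sgd_step_expectation:
  fixes F :: "'a::euclidean_space \<Rightarrow> real" and x g :: "'w \<Rightarrow> 'a" and xs :: 'a
    and \<sigma> \<sigma>' :: "'w \<Rightarrow> real"
  assumes "prob_space M" and "subalgebra M G"
    and F: "convex_on UNIV F" "smooth_fun \<nu> F" "strongly_convex \<mu> F"
    and x: "x \<in> borel_measurable G" and g [measurable]: "g \<in> borel_measurable M"
    and \<sigma>' [measurable]: "\<sigma>' \<in> borel_measurable M"
    and x_int: "integrable M (\<lambda>\<omega>. (norm (x \<omega> - xs))\<^sup>2)"
    and \<sigma>_int: "integrable M (\<lambda>\<omega>. (\<sigma> \<omega>)\<^sup>2)"
    and mean: "AE \<omega> in M. vec_cond_exp M G g \<omega> = grad F (x \<omega>)"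
    and g_ce: "AE \<omega> in M. nn_cond_exp M G (\<lambda>\<omega>. ennreal ((norm (g \<omega> - grad F xs))\<^sup>2)) \<omega>
        \<le> ennreal (2 * \<alpha> * bregman F (x \<omega>) xs + \<beta> * (\<sigma> \<omega>)\<^sup>2)"
    and \<sigma>_ce: "AE \<omega> in M. nn_cond_exp M G (\<lambda>\<omega>. ennreal ((\<sigma>' \<omega>)\<^sup>2)) \<omega>
        \<le> ennreal ((1 - \<rho>) * (\<sigma> \<omega>)\<^sup>2 + 2 * \<delta> * bregman F (x \<omega>) xs)"
    and par: "0 \<le> \<alpha>" "0 \<le> \<beta>" "0 \<le> \<delta>" "\<rho> \<le> 1" "0 < \<gamma>" "0 < \<kappa>" "\<gamma> * (\<alpha> + \<kappa> * \<delta>) \<le> 1"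
  shows "integrable M (\<lambda>\<omega>. (norm (g \<omega> - grad F xs))\<^sup>2)" and "integrable M (\<lambda>\<omega>. (\<sigma>' \<omega>)\<^sup>2)"
    and "(\<integral>\<omega>. (norm (x \<omega> - xs - \<gamma> *\<^sub>R (g \<omega> - grad F xs)))\<^sup>2 \<partial>M) + \<kappa> * \<gamma>\<^sup>2 * (\<integral>\<omega>. (\<sigma>' \<omega>)\<^sup>2 \<partial>M)
      \<le> (1 - \<gamma> * \<mu>) * (\<integral>\<omega>. (norm (x \<omega> - xs))\<^sup>2 \<partial>M)
        + \<kappa> * \<gamma>\<^sup>2 * ((1 - \<rho> + \<beta> / \<kappa>) * (\<integral>\<omega>. (\<sigma> \<omega>)\<^sup>2 \<partial>M))"
proof -
  interpret prob_space M by fact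
  interpret finite_measure_subalgebra M G by unfold_locales fact
  have xM [measurable]: "x \<in> borel_measurable M"
    by (rule measurable_from_subalg[OF assms(2) x])
  have diff: "F differentiable (at z)" for z
    using F(2) by (simp add: smooth_fun_def)
  have D_nn: "0 \<le> bregman F z z'" for z z'
    by (rule bregman_nonneg[OF F(1) diff])
  have D_meas [measurable]: "(\<lambda>\<omega>. bregman F (x \<omega>) xs) \<in> borel_measurable M"
    by (rule borel_measurable_continuous_on[OF continuous_on_bregman_smooth[OF F(2)] xM])
  have gx_meas [measurable]: "(\<lambda>\<omega>. grad F (x \<omega>)) \<in> borel_measurable M"
    by (rule borel_measurable_continuous_on[OF continuous_on_grad_smooth[OF F(2)] xM])
  have D_int: "integrable M (\<lambda>\<omega>. bregman F (x \<omega>) xs)"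
  proof (rule Bochner_Integration.integrable_bound)
    show "integrable M (\<lambda>\<omega>. \<nu> * (norm (x \<omega> - xs))\<^sup>2)" using x_int by simp
    show "AE \<omega> in M. norm (bregman F (x \<omega>) xs) \<le> norm (\<nu> * (norm (x \<omega> - xs))\<^sup>2)"
      using smooth_convex_bregman_le[OF F(1,2)] D_nn by (intro AE_I2) (simp add: order_trans[OF _ abs_ge_self])
  qed measurable
  let ?D = "\<integral>\<omega>. bregman F (x \<omega>) xs \<partial>M" and ?S = "\<integral>\<omega>. (\<sigma> \<omega>)\<^sup>2 \<partial>M"
  let ?E = "\<integral>\<omega>. (norm (x \<omega> - xs))\<^sup>2 \<partial>M"
  have "integrable M (\<lambda>\<omega>. 2 * \<alpha> * bregman F (x \<omega>) xs + \<beta> * (\<sigma> \<omega>)\<^sup>2)"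
    using D_int \<sigma>_int by simp
  note g2 = integral_le_of_nn_cond_exp_le[OF _ this _ _ g_ce]
  show g_int: "integrable M (\<lambda>\<omega>. (norm (g \<omega> - grad F xs))\<^sup>2)"
    by (rule g2(1)) (use par D_nn in auto)
  have g_le: "(\<integral>\<omega>. (norm (g \<omega> - grad F xs))\<^sup>2 \<partial>M) \<le> 2 * \<alpha> * ?D + \<beta> * ?S"
    using g2(2) par D_nn D_int \<sigma>_int by simp
  have "integrable M (\<lambda>\<omega>. (1 - \<rho>) * (\<sigma> \<omega>)\<^sup>2 + 2 * \<delta> * bregman F (x \<omega>) xs)"
    using D_int \<sigma>_int by simp
  note s2 = integral_le_of_nn_cond_exp_le[OF _ this _ _ \<sigma>_ce]
  show \<sigma>'_int: "integrable M (\<lambda>\<omega>. (\<sigma>' \<omega>)\<^sup>2)"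
    by (rule s2(1)) (use par D_nn in auto)
  have \<sigma>'_le: "(\<integral>\<omega>. (\<sigma>' \<omega>)\<^sup>2 \<partial>M) \<le> (1 - \<rho>) * ?S + 2 * \<delta> * ?D"
    using s2(2) par D_nn D_int \<sigma>_int by simp
  let ?c = "grad F xs"
  have cross_int: "integrable M (\<lambda>\<omega>. (x \<omega> - xs) \<bullet> (g \<omega> - ?c))"
    by (rule integrable_inner_square_integrable[OF _ _ x_int g_int]) measurable
  have lip: "norm (grad F z - ?c) \<le> \<nu> * norm (z - xs)" for z
    using F(2) unfolding smooth_fun_def lipschitz_on_def dist_norm by blast
  have gx_int: "integrable M (\<lambda>\<omega>. (norm (grad F (x \<omega>) - ?c))\<^sup>2)"
  proof (rule Bochner_Integration.integrable_bound)
    show "integrable M (\<lambda>\<omega>. \<nu>\<^sup>2 * (norm (x \<omega> - xs))\<^sup>2)" using x_int by simp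
    show "AE \<omega> in M. norm ((norm (grad F (x \<omega>) - ?c))\<^sup>2) \<le> norm (\<nu>\<^sup>2 * (norm (x \<omega> - xs))\<^sup>2)"
      using power_mono[OF lip norm_ge_zero, where n=2] by (simp add: power_mult_distrib)
  qed measurable
  have x_c: "integrable M (\<lambda>\<omega>. (x \<omega> - xs) \<bullet> ?c)"
    by (rule integrable_inner_square_integrable[OF _ _ x_int]) auto
  have gg: "integrable M (\<lambda>\<omega>. (norm (g \<omega>))\<^sup>2)"
    using integrable_norm_power2_add[of "\<lambda>\<omega>. g \<omega> - ?c" M "\<lambda>_. ?c"] g_int by simp
  have grad_int: "integrable M (\<lambda>\<omega>. (x \<omega> - xs) \<bullet> (grad F (x \<omega>) - ?c))"
    by (rule integrable_inner_square_integrable[OF _ _ x_int gx_int]) measurable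
  have xg: "integrable M (\<lambda>\<omega>. (x \<omega> - xs) \<bullet> g \<omega>)"
    by (rule integrable_inner_square_integrable[OF _ _ x_int gg]) measurable
  have xgF: "integrable M (\<lambda>\<omega>. (x \<omega> - xs) \<bullet> grad F (x \<omega>))"
    using Bochner_Integration.integrable_add[OF grad_int x_c] by (simp add: inner_simps)
  \<comment> \<open>The error \<open>x - xs\<close> is measurable for \<open>G\<close>, so the
    conditional mean may replace \<open>g\<close>.\<close>
  have "(\<integral>\<omega>. (x \<omega> - xs) \<bullet> g \<omega> \<partial>M) = (\<integral>\<omega>. (x \<omega> - xs) \<bullet> grad F (x \<omega>) \<partial>M)"
    by (rule integral_inner_vec_cond_exp[OF _ g gx_meas x_int gg mean]) (use x in measurable)
  then have "(\<integral>\<omega>. (x \<omega> - xs) \<bullet> (g \<omega> - ?c) \<partial>M) = (\<integral>\<omega>. (x \<omega> - xs) \<bullet> (grad F (x \<omega>) - ?c) \<partial>M)"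
    unfolding inner_diff_right[of "_ - _"] using xg xgF x_c by simp
  \<comment> \<open>The inner product is the sum of the two swapped divergences; one is kept and
    strong convexity bounds the other.\<close>
  also have "\<dots> \<ge> (\<integral>\<omega>. bregman F (x \<omega>) xs + \<mu> / 2 * (norm (x \<omega> - xs))\<^sup>2 \<partial>M)"
  proof (rule integral_mono)
    show "bregman F (x \<omega>) xs + \<mu> / 2 * (norm (x \<omega> - xs))\<^sup>2 \<le> (x \<omega> - xs) \<bullet> (grad F (x \<omega>) - ?c)" for \<omega>
      using bregman_add_swap[of F "x \<omega>" xs] strongly_convex_bregman_ge[OF F(3) diff, of xs "x \<omega>"]
      by (simp add: norm_minus_commute)
  qed (use D_int x_int grad_int in auto)
  finally have cross: "?D + \<mu> / 2 * ?E \<le> (\<integral>\<omega>. (x \<omega> - xs) \<bullet> (g \<omega> - ?c) \<partial>M)"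
    using D_int x_int by simp
  have "(\<integral>\<omega>. (norm (x \<omega> - xs - \<gamma> *\<^sub>R (g \<omega> - ?c)))\<^sup>2 \<partial>M)
      = (\<integral>\<omega>. (norm (x \<omega> - xs))\<^sup>2 - 2 * \<gamma> * ((x \<omega> - xs) \<bullet> (g \<omega> - ?c))
          + \<gamma>\<^sup>2 * (norm (g \<omega> - ?c))\<^sup>2 \<partial>M)"
    by (simp only: norm_power2_diff_scaleR)
  also have "\<dots> = ?E - 2 * \<gamma> * (\<integral>\<omega>. (x \<omega> - xs) \<bullet> (g \<omega> - ?c) \<partial>M)
      + \<gamma>\<^sup>2 * (\<integral>\<omega>. (norm (g \<omega> - ?c))\<^sup>2 \<partial>M)"
    using x_int cross_int g_int by simp
  also have "\<dots> \<le> ?E - 2 * \<gamma> * (?D + \<mu> / 2 * ?E) + \<gamma>\<^sup>2 * (2 * \<alpha> * ?D + \<beta> * ?S)"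
    using cross g_le par by (intro add_mono diff_mono mult_left_mono) auto
  finally have "(\<integral>\<omega>. (norm (x \<omega> - xs - \<gamma> *\<^sub>R (g \<omega> - ?c)))\<^sup>2 \<partial>M) + \<kappa> * \<gamma>\<^sup>2 * (\<integral>\<omega>. (\<sigma>' \<omega>)\<^sup>2 \<partial>M)
      \<le> ?E - 2 * \<gamma> * (?D + \<mu> / 2 * ?E) + \<gamma>\<^sup>2 * (2 * \<alpha> * ?D + \<beta> * ?S)
        + \<kappa> * \<gamma>\<^sup>2 * ((1 - \<rho>) * ?S + 2 * \<delta> * ?D)"
    by (rule add_mono) (use \<sigma>'_le par in \<open>auto intro: mult_left_mono\<close>)
  \<comment> \<open>The coefficients of \<open>?D\<close> combine to -2\<gamma> (1 - \<gamma>
    (\<alpha> + \<kappa>\<delta>)), which the bound on \<gamma> makes nonpositive.\<close>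
  also have "\<dots> = (1 - \<gamma> * \<mu>) * ?E + \<kappa> * \<gamma>\<^sup>2 * ((1 - \<rho> + \<beta> / \<kappa>) * ?S)
      - 2 * \<gamma> * ((1 - \<gamma> * (\<alpha> + \<kappa> * \<delta>)) * ?D)"
  proof -
    have "\<kappa> * \<gamma>\<^sup>2 * ((1 - \<rho> + \<beta> / \<kappa>) * ?S) = \<gamma>\<^sup>2 * (\<beta> * ?S) + \<kappa> * \<gamma>\<^sup>2 * ((1 - \<rho>) * ?S)"
      using par(6) by (simp add: distrib_left distrib_right)
    then show ?thesis by (simp add: power2_eq_square algebra_simps)
  qed
  also have "\<dots> \<le> (1 - \<gamma> * \<mu>) * ?E + \<kappa> * \<gamma>\<^sup>2 * ((1 - \<rho> + \<beta> / \<kappa>) * ?S)"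
    using par D_nn by (simp add: integral_nonneg_AE)
  finally show "(\<integral>\<omega>. (norm (x \<omega> - xs - \<gamma> *\<^sub>R (g \<omega> - ?c)))\<^sup>2 \<partial>M) + \<kappa> * \<gamma>\<^sup>2 * (\<integral>\<omega>. (\<sigma>' \<omega>)\<^sup>2 \<partial>M)
      \<le> (1 - \<gamma> * \<mu>) * ?E + \<kappa> * \<gamma>\<^sup>2 * ((1 - \<rho> + \<beta> / \<kappa>) * ?S)" .
qed

section \<open>Range invariance, error recursion and measurability of the iterates\<close>

lemma licosgd_range:
  fixes L :: "'a::euclidean_space \<Rightarrow> 'b::euclidean_space"
  assumes "linear L" "licosgd L b \<gamma> \<tau> x0 y0 g x y w" "y0 \<in> range L" "b \<in> range L"
  shows "y k \<in> range L"
proof (induction k)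
  case 0
  then show ?case using assms by (simp add: licosgd_def)
next
  case (Suc k)
  have sub: "subspace (range L)" using assms(1) by (simp add: linear_subspace_image)
  have "y (Suc k) = y k + \<tau> *\<^sub>R L (w k - \<gamma> *\<^sub>R adjoint L (y k)) - \<tau> *\<^sub>R b"
    using assms(2) by (simp add: licosgd_def)
  then show ?case
    using Suc assms(4) by (auto intro!: subspace_add[OF sub] subspace_diff[OF sub] subspace_scale[OF sub])
qed

text \<open>The optimality conditions absorb the constants: \<open>b\<close> becomes
  \<open>L xs\<close>, and \<open>c\<close>, which stands for the gradient at \<open>xs\<close>,
  becomes \<open>- adjoint L ys\<close>. The identity \<open>p\<close> in the proof serves both the
  old and the new dual iterate.\<close>

lemma licosgd_error:
  fixes L :: "'a::euclidean_space \<Rightarrow> 'b::euclidean_space" and c :: 'a and k :: nat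
  assumes L: "linear L" and alg: "licosgd L b \<gamma> \<tau> x0 y0 g x y w"
    and opt: "L xs = b" "c + adjoint L ys = 0"
  defines "p \<equiv> x k - xs - \<gamma> *\<^sub>R (g (Suc k) - c)"
  shows "y (Suc k) - ys = y k - ys + \<tau> *\<^sub>R L (p - \<gamma> *\<^sub>R adjoint L (y k - ys))"
    and "x (Suc k) - xs = p - \<gamma> *\<^sub>R adjoint L (y (Suc k) - ys)"
proof -
  have w: "w k = x k - \<gamma> *\<^sub>R g (Suc k)" using alg by (simp add: licosgd_def)
  have c: "c = - adjoint L ys" using opt(2) by (simp add: eq_neg_iff_add_eq_0)
  have p: "p - \<gamma> *\<^sub>R adjoint L (z - ys) = w k - \<gamma> *\<^sub>R adjoint L z - xs" for z
    unfolding p_def w c by (simp add: linear_diff[OF adjoint_linear[OF L]] algebra_simps)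
  show "y (Suc k) - ys = y k - ys + \<tau> *\<^sub>R L (p - \<gamma> *\<^sub>R adjoint L (y k - ys))"
    unfolding p linear_diff[OF L, of _ xs] opt(1) using alg by (simp add: licosgd_def algebra_simps)
  show "x (Suc k) - xs = p - \<gamma> *\<^sub>R adjoint L (y (Suc k) - ys)"
    unfolding p using alg by (simp add: licosgd_def)
qed

lemma licosgd_measurable:
  fixes L :: "'a::euclidean_space \<Rightarrow> 'b::euclidean_space"
  assumes L: "linear L" and Fil: "filtration (space M) Fil" and g: "adapted Fil g"
    and alg: "\<And>\<omega>. \<omega> \<in> space M \<Longrightarrow>
      licosgd L b \<gamma> \<tau> x0 y0 (\<lambda>k. g k \<omega>) (\<lambda>k. x k \<omega>) (\<lambda>k. y k \<omega>) (\<lambda>k. w k \<omega>)"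
  shows "x k \<in> borel_measurable (Fil k) \<and> y k \<in> borel_measurable (Fil k)"
proof (induction k)
  case 0
  have "x 0 \<omega> = x0" "y 0 \<omega> = y0" if "\<omega> \<in> space (Fil 0)" for \<omega>
    using alg[of \<omega>] that filtration.space_F[OF Fil] by (auto simp: licosgd_def)
  then show ?case by (simp cong: measurable_cong)
next
  case (Suc k)
  have "subalgebra (Fil (Suc k)) (Fil k)"
    using filtration.space_F[OF Fil] filtration.sets_F_mono[OF Fil, of k "Suc k"]
    by (simp add: subalgebra_def)
  then have xk [measurable]: "x k \<in> borel_measurable (Fil (Suc k))"
    and yk [measurable]: "y k \<in> borel_measurable (Fil (Suc k))"
    using Suc measurable_from_subalg by blast+
  have [measurable]: "g (Suc k) \<in> borel_measurable (Fil (Suc k))"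
    using g by (simp add: adapted_def)
  note meas = borel_measurable_linear[OF L] borel_measurable_linear[OF adjoint_linear[OF L]]
  \<comment> \<open>\<open>X\<close> and \<open>Y\<close> are the right-hand sides as global
    functions. The iterates agree with them only on the sample space, hence the final congruence
    argument.\<close>
  define X where "X = (\<lambda>\<omega>. x k \<omega> - \<gamma> *\<^sub>R g (Suc k) \<omega>)"
  define Y where "Y = (\<lambda>\<omega>. y k \<omega> + \<tau> *\<^sub>R L (X \<omega> - \<gamma> *\<^sub>R adjoint L (y k \<omega>)) - \<tau> *\<^sub>R b)"
  have [measurable]: "X \<in> borel_measurable (Fil (Suc k))"
    unfolding X_def by measurable
  have [measurable]: "(\<lambda>\<omega>. adjoint L (y k \<omega>)) \<in> borel_measurable (Fil (Suc k))"
    by (intro meas) measurable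
  have [measurable]: "(\<lambda>\<omega>. L (X \<omega> - \<gamma> *\<^sub>R adjoint L (y k \<omega>))) \<in> borel_measurable (Fil (Suc k))"
    by (intro meas) measurable
  have Y [measurable]: "Y \<in> borel_measurable (Fil (Suc k))"
    unfolding Y_def by measurable
  have [measurable]: "(\<lambda>\<omega>. adjoint L (Y \<omega>)) \<in> borel_measurable (Fil (Suc k))"
    by (intro meas) measurable
  have "(\<lambda>\<omega>. X \<omega> - \<gamma> *\<^sub>R adjoint L (Y \<omega>)) \<in> borel_measurable (Fil (Suc k))"
    by measurable
  moreover have "y (Suc k) \<omega> = Y \<omega>" "x (Suc k) \<omega> = X \<omega> - \<gamma> *\<^sub>R adjoint L (Y \<omega>)"
    if "\<omega> \<in> space (Fil (Suc k))" for \<omega>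
    using alg[of \<omega>] that filtration.space_F[OF Fil] by (auto simp: licosgd_def X_def Y_def)
  ultimately show ?case
    using Y by (simp cong: measurable_cong)
qed

section \<open>Linear convergence in mean\<close>

theorem theorem6p2:
  fixes L :: "'a::euclidean_space \<Rightarrow> 'b::euclidean_space"
    and F :: "'a \<Rightarrow> real"
    and M :: "'w measure" and Fil :: "nat \<Rightarrow> 'w measure"
    and g x w :: "nat \<Rightarrow> 'w \<Rightarrow> 'a" and y :: "nat \<Rightarrow> 'w \<Rightarrow> 'b" and \<sigma> :: "nat \<Rightarrow> 'w \<Rightarrow> real"
    and b y0 ys :: 'b and x0 xs :: 'a
    and \<nu> \<mu> \<gamma> \<tau> \<alpha> \<beta> \<delta> \<rho> \<kappa> \<sigma>0 :: real
  assumes "linear L" and "L \<noteq> (\<lambda>_. 0)" and "b \<in> range L"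
    and "convex_on UNIV F" and "\<nu> > 0" and "smooth_fun \<nu> F"
    and "\<mu> > 0" and "strongly_convex \<mu> F"
    and "is_arg_min F (\<lambda>u. L u = b) xs"
    and "ys \<in> range L" and "grad F xs + adjoint L ys = 0"
    and "\<gamma> > 0" and "\<tau> > 0" and "y0 \<in> range L"
    and "\<And>\<omega>. \<omega> \<in> space M \<Longrightarrow>
           licosgd L b \<gamma> \<tau> x0 y0 (\<lambda>k. g k \<omega>) (\<lambda>k. x k \<omega>) (\<lambda>k. y k \<omega>) (\<lambda>k. w k \<omega>)"
    and "\<And>\<omega>. \<omega> \<in> space M \<Longrightarrow> \<sigma> 0 \<omega> = \<sigma>0"
    and "stochastic_gradient M Fil F xs x g \<sigma> \<alpha> \<beta> \<delta> \<rho>"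
    and "\<gamma> * \<tau> * (onorm L)\<^sup>2 < 1"
    and "\<kappa> > \<beta> / \<rho>"
    \<comment> \<open>as usual, \<open>1 / 0 = \<infinity>\<close>\<close>
    and "\<alpha> + \<kappa> * \<delta> \<noteq> 0 \<Longrightarrow> \<gamma> \<le> 1 / (\<alpha> + \<kappa> * \<delta>)"
  shows "rate L \<gamma> \<tau> \<mu> \<rho> \<beta> \<kappa> < 1 \<and>
    (\<forall>k. integrable M (\<lambda>\<omega>. (\<sigma> k \<omega>)\<^sup>2) \<and>
         integrable M (lyapunov M L \<gamma> \<tau> \<kappa> xs ys x y \<sigma> k) \<and>
         (\<forall>\<omega>\<^sub>0\<in>space M. (\<integral>\<omega>. lyapunov M L \<gamma> \<tau> \<kappa> xs ys x y \<sigma> k \<omega> \<partial>M)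
            \<le> rate L \<gamma> \<tau> \<mu> \<rho> \<beta> \<kappa> ^ k * lyapunov M L \<gamma> \<tau> \<kappa> xs ys x y \<sigma> 0 \<omega>\<^sub>0))"
proof -
  note L = assms(1,2) and \<gamma> = \<open>0 < \<gamma>\<close> and \<tau> = \<open>0 < \<tau>\<close> and alg = assms(15)
  note sg = assms(17)[unfolded stochastic_gradient_def]
  have step: "\<gamma> * \<tau> * (onorm L)\<^sup>2 \<le> 1" using assms(18) by simp
  have Lxs: "L xs = b" using assms(9) by (simp add: is_arg_min_def)
  have par: "0 \<le> \<alpha>" "0 \<le> \<beta>" "0 \<le> \<delta>" "0 < \<rho>" "\<rho> \<le> 1"
    using sg by simp_all
  have \<kappa>: "0 < \<kappa>" using assms(19) par by (meson divide_nonneg_pos le_less_trans)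
  \<comment> \<open>If \<alpha> + \<kappa>\<delta> vanishes, the step-size hypothesis says nothing
    and the product is 0.\<close>
  have \<gamma>_le: "\<gamma> * (\<alpha> + \<kappa> * \<delta>) \<le> 1"
  proof (cases "\<alpha> + \<kappa> * \<delta> = 0")
    case False
    moreover have "0 \<le> \<alpha> + \<kappa> * \<delta>" using par \<kappa> by simp
    ultimately show ?thesis using assms(20) by (simp add: pos_le_divide_eq)
  qed simp
  interpret prob_space M using sg by simp
  have Fil: "filtration (space M) Fil" and subalg: "\<And>k. subalgebra M (Fil k)"
    and g: "adapted Fil g" and \<sigma>: "adapted Fil \<sigma>"
    using sg by simp_all
  define \<theta> where "\<theta> = \<tau> * \<gamma> * min_pos_eigenvalue (adjoint L \<circ> L)"
  define r where "r = rate L \<gamma> \<tau> \<mu> \<rho> \<beta> \<kappa>"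
  have \<theta>: "0 < \<theta>"
    unfolding \<theta>_def using \<gamma> \<tau> min_pos_eigenvalue_adjoint_comp(1)[OF L] by simp
  have r: "1 - \<gamma> * \<mu> \<le> r" "1 - \<rho> + \<beta> / \<kappa> \<le> r" "1 / (1 + \<theta>) \<le> r"
    unfolding r_def rate_def \<theta>_def[symmetric] by simp_all
  have "\<beta> / \<kappa> < \<rho>"
    using assms(19) par \<kappa> by (simp add: field_simps)
  then have "r < 1"
    unfolding r_def rate_def \<theta>_def[symmetric] using \<gamma> \<open>0 < \<mu>\<close> \<theta> by simp
  \<comment> \<open>The positive entry 1/(1 + \<theta>) decides; no sign of
    \<open>1 - \<gamma> * \<mu>\<close> is required.\<close>
  have r_nn: "0 \<le> r" using r(3) \<theta> by (smt (verit) divide_pos_pos)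

  have meas: "x k \<in> borel_measurable (Fil k)" "y k \<in> borel_measurable (Fil k)" for k
    using licosgd_measurable[OF L(1) Fil g alg] by blast+
  have [measurable]: "x k \<in> borel_measurable M" "y k \<in> borel_measurable M"
    and g\<sigma>_meas [measurable]: "g k \<in> borel_measurable M" "\<sigma> k \<in> borel_measurable M" for k
    using meas g \<sigma> measurable_from_subalg[OF subalg] unfolding adapted_def by blast+
  define p where "p = (\<lambda>k \<omega>. x k \<omega> - xs - \<gamma> *\<^sub>R (g (Suc k) \<omega> - grad F xs))"
  have [measurable]: "p k \<in> borel_measurable M" for k unfolding p_def by measurable
  let ?X = "\<lambda>k \<omega>. (norm (x k \<omega> - xs))\<^sup>2" and ?Y = "\<lambda>k \<omega>. (norm (y k \<omega> - ys))\<^sup>2"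
    and ?S = "\<lambda>k \<omega>. (\<sigma> k \<omega>)\<^sup>2" and ?N = "\<lambda>k \<omega>. (dual_norm L \<gamma> \<tau> (y k \<omega> - ys))\<^sup>2"
    and ?P = "\<lambda>k \<omega>. (norm (p k \<omega>))\<^sup>2"
  have y_rec: "y (Suc k) \<omega> - ys = y k \<omega> - ys + \<tau> *\<^sub>R L (p k \<omega> - \<gamma> *\<^sub>R adjoint L (y k \<omega> - ys))"
    and x_rec: "x (Suc k) \<omega> - xs = p k \<omega> - \<gamma> *\<^sub>R adjoint L (y (Suc k) \<omega> - ys)"
    if "\<omega> \<in> space M" for k \<omega>
    using licosgd_error[OF L(1) alg[OF that] Lxs assms(11)] by (simp_all add: p_def)
  have N: "?N k = (\<lambda>\<omega>. \<gamma> / \<tau> * ?Y k \<omega> - \<gamma>\<^sup>2 * (norm (adjoint L (y k \<omega> - ys)))\<^sup>2)" for k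
    using dual_norm_power2[OF L(1) \<gamma> \<tau> step] by simp
  have linA: "linear (\<lambda>u. c *\<^sub>R adjoint L u)" and linL: "linear (\<lambda>u. c *\<^sub>R L u)" for c
    by (intro linear_compose_scale_right adjoint_linear L(1))+
  have x_diff_meas: "(\<lambda>\<omega>. x k \<omega> - xs) \<in> borel_measurable M"
    and y_diff_meas: "(\<lambda>\<omega>. y k \<omega> - ys) \<in> borel_measurable M" for k
    by measurable
  \<comment> \<open>Conditional on integrability at step \<open>k\<close>, because it feeds the
    induction that establishes integrability for all \<open>k\<close>.\<close>
  have sgd_k: "integrable M (\<lambda>\<omega>. (norm (g (Suc k) \<omega> - grad F xs))\<^sup>2)" "integrable M (?S (Suc k))"
    "(\<integral>\<omega>. ?P k \<omega> \<partial>M) + \<kappa> * \<gamma>\<^sup>2 * (\<integral>\<omega>. ?S (Suc k) \<omega> \<partial>M)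
      \<le> (1 - \<gamma> * \<mu>) * (\<integral>\<omega>. ?X k \<omega> \<partial>M) + \<kappa> * \<gamma>\<^sup>2 * ((1 - \<rho> + \<beta> / \<kappa>) * (\<integral>\<omega>. ?S k \<omega> \<partial>M))"
    if "integrable M (?X k)" "integrable M (?S k)" for k
  proof -
    have "AE \<omega> in M. vec_cond_exp M (Fil k) (g (Suc k)) \<omega> = grad F (x k \<omega>)"
      and "AE \<omega> in M. nn_cond_exp M (Fil k) (\<lambda>\<omega>. ennreal ((norm (g (Suc k) \<omega> - grad F xs))\<^sup>2)) \<omega>
        \<le> ennreal (2 * \<alpha> * bregman F (x k \<omega>) xs + \<beta> * (\<sigma> k \<omega>)\<^sup>2)"
      and "AE \<omega> in M. nn_cond_exp M (Fil k) (\<lambda>\<omega>. ennreal ((\<sigma> (Suc k) \<omega>)\<^sup>2)) \<omega>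
        \<le> ennreal ((1 - \<rho>) * (\<sigma> k \<omega>)\<^sup>2 + 2 * \<delta> * bregman F (x k \<omega>) xs)"
      using sg by simp_all
    note sgd = sgd_step_expectation[OF prob_space_axioms subalg assms(4,6,8) meas(1) g\<sigma>_meas that this
        par(1-3,5) \<gamma> \<kappa> \<gamma>_le]
    show "integrable M (\<lambda>\<omega>. (norm (g (Suc k) \<omega> - grad F xs))\<^sup>2)" "integrable M (?S (Suc k))"
      by (fact sgd(1,2))+
    show "(\<integral>\<omega>. ?P k \<omega> \<partial>M) + \<kappa> * \<gamma>\<^sup>2 * (\<integral>\<omega>. ?S (Suc k) \<omega> \<partial>M)
      \<le> (1 - \<gamma> * \<mu>) * (\<integral>\<omega>. ?X k \<omega> \<partial>M) + \<kappa> * \<gamma>\<^sup>2 * ((1 - \<rho> + \<beta> / \<kappa>) * (\<integral>\<omega>. ?S k \<omega> \<partial>M))"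
      unfolding p_def by (fact sgd(3))
  qed
  have P_int: "integrable M (?P k)" if "integrable M (?X k)" "integrable M (?S k)" for k
    using integrable_norm_power2_add[OF x_diff_meas _ that(1), of "\<lambda>\<omega>. - \<gamma> *\<^sub>R (g (Suc k) \<omega> - grad F xs)"]
      sgd_k(1)[OF that]
    by (simp add: p_def power_mult_distrib)
  have A_int: "integrable M (\<lambda>\<omega>. (norm (c *\<^sub>R adjoint L (y k \<omega> - ys)))\<^sup>2)" if "integrable M (?Y k)" for k c
    by (rule integrable_norm_power2_linear[OF linA y_diff_meas that])
  have N_int: "integrable M (?N k)" if "integrable M (?Y k)" for k
    unfolding N using A_int[OF that, of 1] that by simp
  have A_meas: "(\<lambda>\<omega>. c *\<^sub>R adjoint L (y k \<omega> - ys)) \<in> borel_measurable M" for k c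
    by (rule borel_measurable_linear[OF linA y_diff_meas])
  have int: "integrable M (?X k) \<and> integrable M (?Y k) \<and> integrable M (?S k)" for k
  proof (induction k)
    case 0
    have "x 0 \<omega> = x0" "y 0 \<omega> = y0" "\<sigma> 0 \<omega> = \<sigma>0" if "\<omega> \<in> space M" for \<omega>
      using alg[OF that] assms(16)[OF that] by (simp_all add: licosgd_def)
    then show ?case by (simp cong: Bochner_Integration.integrable_cong)
  next
    case (Suc k)
    then have P: "integrable M (?P k)" and S: "integrable M (?S (Suc k))"
      using P_int sgd_k(2) by blast+
    \<comment> \<open>The order matters: \<open>p\<close> is square integrable by the gradient step,
      then \<open>q\<close>, then the new dual error built from \<open>L q\<close>, and only then
      the new primal error.\<close>
    define q where "q = (\<lambda>\<omega>. p k \<omega> + - \<gamma> *\<^sub>R adjoint L (y k \<omega> - ys))"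
    have q_meas: "q \<in> borel_measurable M"
      unfolding q_def by (intro borel_measurable_add A_meas) measurable
    have q_int: "integrable M (\<lambda>\<omega>. (norm (q \<omega>))\<^sup>2)"
      unfolding q_def using Suc P by (intro integrable_norm_power2_add A_meas A_int) auto
    have "integrable M (\<lambda>\<omega>. (norm (y k \<omega> - ys + \<tau> *\<^sub>R L (q \<omega>)))\<^sup>2)"
      using Suc by (intro integrable_norm_power2_add y_diff_meas
        borel_measurable_linear[OF linL q_meas] integrable_norm_power2_linear[OF linL q_meas q_int]) blast
    moreover have "?Y (Suc k) \<omega> = (norm (y k \<omega> - ys + \<tau> *\<^sub>R L (q \<omega>)))\<^sup>2" if "\<omega> \<in> space M" for \<omega>
      unfolding y_rec[OF that] q_def by simp
    ultimately have Y: "integrable M (?Y (Suc k))"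
      by (simp only: cong: Bochner_Integration.integrable_cong)
    have "integrable M (\<lambda>\<omega>. (norm (p k \<omega> + - \<gamma> *\<^sub>R adjoint L (y (Suc k) \<omega> - ys)))\<^sup>2)"
      using Y P by (intro integrable_norm_power2_add A_meas A_int) auto
    moreover have "?X (Suc k) \<omega> = (norm (p k \<omega> + - \<gamma> *\<^sub>R adjoint L (y (Suc k) \<omega> - ys)))\<^sup>2"
      if "\<omega> \<in> space M" for \<omega>
      unfolding x_rec[OF that] by simp
    ultimately have "integrable M (?X (Suc k))"
      by (simp only: cong: Bochner_Integration.integrable_cong)
    with Y S show ?case by blast
  qed
  have N_int: "integrable M (?N k)" for k
    using N_int int by blast

  let ?V = "lyapunov M L \<gamma> \<tau> \<kappa> xs ys x y \<sigma>"
  have V: "?V k = (\<lambda>\<omega>. ?X k \<omega> + (1 + \<theta>) * ?N k \<omega> + \<kappa> * \<gamma>\<^sup>2 * (\<integral>\<omega>. ?S k \<omega> \<partial>M))" for k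
    unfolding \<theta>_def by (rule ext) (rule lyapunov_def)
  have V_int: "integrable M (?V k)" for k
    unfolding V using int N_int by simp
  have EV: "(\<integral>\<omega>. ?V k \<omega> \<partial>M) = (\<integral>\<omega>. ?X k \<omega> \<partial>M) + (1 + \<theta>) * (\<integral>\<omega>. ?N k \<omega> \<partial>M)
      + \<kappa> * \<gamma>\<^sup>2 * (\<integral>\<omega>. ?S k \<omega> \<partial>M)" for k
    unfolding V using int N_int by (simp add: prob_space)
  have dec: "(\<integral>\<omega>. ?V (Suc k) \<omega> \<partial>M) \<le> r * (\<integral>\<omega>. ?V k \<omega> \<partial>M)" for k
  proof -
    have path: "?X (Suc k) \<omega> + (1 + \<theta>) * ?N (Suc k) \<omega> \<le> ?P k \<omega> + ?N k \<omega>" if "\<omega> \<in> space M" for \<omega>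
    proof -
      have sub: "subspace (range L)" using L(1) by (simp add: linear_subspace_image)
      have "y k \<omega> - ys \<in> range L"
        by (intro subspace_diff[OF sub] licosgd_range[OF L(1) alg[OF that]] assms)
      from licosgd_step_le[OF L \<gamma> \<tau> step y_rec[OF that] this] show ?thesis
        unfolding x_rec[OF that] \<theta>_def .
    qed
    have P: "integrable M (?P k)" using P_int int by blast
    have "(\<integral>\<omega>. ?X (Suc k) \<omega> \<partial>M) + (1 + \<theta>) * (\<integral>\<omega>. ?N (Suc k) \<omega> \<partial>M)
        = (\<integral>\<omega>. ?X (Suc k) \<omega> + (1 + \<theta>) * ?N (Suc k) \<omega> \<partial>M)"
      using int N_int by simp
    also have "\<dots> \<le> (\<integral>\<omega>. ?P k \<omega> + ?N k \<omega> \<partial>M)"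
      using int N_int P path by (intro integral_mono) auto
    also have "\<dots> = (\<integral>\<omega>. ?P k \<omega> \<partial>M) + (\<integral>\<omega>. ?N k \<omega> \<partial>M)"
      using P N_int by simp
    \<comment> \<open>The coefficient 1 of the old dual term is split as 1/(1 + \<theta>) times the
      weight 1 + \<theta> that it carries in the Lyapunov function.\<close>
    finally have "(\<integral>\<omega>. ?V (Suc k) \<omega> \<partial>M) \<le> (1 - \<gamma> * \<mu>) * (\<integral>\<omega>. ?X k \<omega> \<partial>M)
        + (1 / (1 + \<theta>)) * ((1 + \<theta>) * (\<integral>\<omega>. ?N k \<omega> \<partial>M))
        + \<kappa> * \<gamma>\<^sup>2 * ((1 - \<rho> + \<beta> / \<kappa>) * (\<integral>\<omega>. ?S k \<omega> \<partial>M))"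
      unfolding EV using sgd_k(3)[of k] int \<theta> by simp
    also have "\<dots> \<le> r * (\<integral>\<omega>. ?X k \<omega> \<partial>M) + r * ((1 + \<theta>) * (\<integral>\<omega>. ?N k \<omega> \<partial>M))
        + \<kappa> * \<gamma>\<^sup>2 * (r * (\<integral>\<omega>. ?S k \<omega> \<partial>M))"
      using r \<kappa> \<theta> by (intro add_mono mult_left_mono mult_right_mono) (auto simp: integral_nonneg_AE)
    also have "\<dots> = r * (\<integral>\<omega>. ?V k \<omega> \<partial>M)"
      unfolding EV by (simp add: algebra_simps)
    finally show ?thesis .
  qed
  have bound: "(\<integral>\<omega>. ?V k \<omega> \<partial>M) \<le> r ^ k * (\<integral>\<omega>. ?V 0 \<omega> \<partial>M)" for k
  proof (induction k)
    case (Suc k)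
    then show ?case
      using order_trans[OF dec mult_left_mono[OF Suc r_nn]] by (simp add: mult.assoc)
  qed simp
  \<comment> \<open>The initial data are deterministic, so the initial Lyapunov value is constant on
    the sample space and equals its mean.\<close>
  have V0: "(\<integral>\<omega>. ?V 0 \<omega> \<partial>M) = ?V 0 \<omega>\<^sub>0" if "\<omega>\<^sub>0 \<in> space M" for \<omega>\<^sub>0
  proof -
    have "?V 0 \<omega> = ?V 0 \<omega>\<^sub>0" if "\<omega> \<in> space M" for \<omega>
      using alg[OF that] alg[OF \<open>\<omega>\<^sub>0 \<in> space M\<close>] by (simp add: lyapunov_def licosgd_def)
    then have "(\<integral>\<omega>. ?V 0 \<omega> \<partial>M) = (\<integral>\<omega>. ?V 0 \<omega>\<^sub>0 \<partial>M)"
      by (rule Bochner_Integration.integral_cong[OF refl])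
    then show ?thesis by (simp add: prob_space)
  qed
  have "(\<integral>\<omega>. ?V k \<omega> \<partial>M) \<le> r ^ k * ?V 0 \<omega>\<^sub>0" if "\<omega>\<^sub>0 \<in> space M" for k \<omega>\<^sub>0
    using bound[of k] V0[OF that] by simp
  then show ?thesis
    using \<open>r < 1\<close> int V_int unfolding r_def[symmetric] by simp
qed

end
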